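(* Let $p$ be a prime and let $q$ be a power of $p$ with $q\neq 2$ and $q\neq p^2$. Let $\ell$ be an odd prime such that $q$ is a primitive root modulo $\ell^t$ for each integer $t\geq 1$. Then $h_q(\ell^t)=0$.
   Context: For a prime power $q$ and $n\in\mathbb{N}$, let $e_0,\dots,e_{n-1}$ be the standard basis of $\mathbb{F}_q^n$ (indices mod $n$) and let $\tau:\mathbb{F}_q^n\to\mathbb{F}_q^n$ be the cyclic shift $\sum_i a_ie_i\mapsto\sum_i a_ie_{i+1}$. A subspace $U\subseteq\mathbb{F}_q^n$ is cyclically covering if $\bigcup_{i=0}^{n-1}\tau^i(U)=\mathbb{F}_q^n$. $h_q(n)$ denotes the largest codimension of a cyclically covering subspace of $\mathbb{F}_q^n$ (so $h_q(n)=0$ means the only cyclically covering subspace is $\mathbb{F}_q^n$ itself). *)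

theory Defs
  imports
    "HOL-Library.Cardinality"
    "Jordan_Normal_Form.VS_Connect"
    "HOL-Number_Theory.Residue_Primitive_Roots"
begin

text \<open>The entry of the shifted vector at position \<open>j\<close> is the entry of \<open>v\<close> at position
  \<open>j - 1\<close> modulo \<open>n\<close>; see \<open>cyclic_shift_sum\<close> below for the description in the standard basis.\<close>

definition cyclic_shift :: "'a vec \<Rightarrow> 'a vec" where
  "cyclic_shift v = vec (dim_vec v) (\<lambda>j. v $ ((j + dim_vec v - 1) mod dim_vec v))"

lemma cyclic_shift_unit_vec:
  assumes "i < n"
  shows "cyclic_shift (unit_vec n i :: 'a :: zero_neq_one vec) = unit_vec n ((i + 1) mod n)"
proof -
  have "(j + n - 1) mod n = i \<longleftrightarrow> j = (i + 1) mod n" if "j < n" for j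
    using that assms by (cases j) (auto simp: mod_Suc)
  then show ?thesis
    using assms by (intro eq_vecI) (auto simp: cyclic_shift_def unit_vec_def)
qed

lemma cyclic_shift_sum:
  fixes v :: "'a :: comm_ring_1 vec"
  assumes "v \<in> carrier_vec n"
  shows "cyclic_shift v =
    vec n (\<lambda>j. \<Sum>i<n. (v $ i \<cdot>\<^sub>v unit_vec n ((i + 1) mod n)) $ j)"
proof (intro eq_vecI)
  fix j assume "j < dim_vec (vec n (\<lambda>j. \<Sum>i<n. (v $ i \<cdot>\<^sub>v unit_vec n ((i + 1) mod n)) $ j))"
  then have j: "j < n" by simp
  have eq: "j = (i + 1) mod n \<longleftrightarrow> i = (j + n - 1) mod n" if "i < n" for i
    using that j by (cases j) (auto simp: mod_Suc)
  have "(\<Sum>i<n. (v $ i \<cdot>\<^sub>v unit_vec n ((i + 1) mod n)) $ j) =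
      (\<Sum>i<n. if i = (j + n - 1) mod n then v $ i else 0)"
    using j eq by (intro sum.cong) (auto simp: unit_vec_def)
  also have "\<dots> = v $ ((j + n - 1) mod n)"
    using j by simp
  finally show "cyclic_shift v $ j =
      vec n (\<lambda>j. \<Sum>i<n. (v $ i \<cdot>\<^sub>v unit_vec n ((i + 1) mod n)) $ j) $ j"
    using j assms by (simp add: cyclic_shift_def)
qed (use assms in \<open>simp add: cyclic_shift_def\<close>)

definition cyclically_covering :: "nat \<Rightarrow> 'a :: field vec set \<Rightarrow> bool" where
  "cyclically_covering n U \<longleftrightarrow>
     VectorSpace.subspace class_ring U (module_vec TYPE('a) n) \<and>
     (\<Union>i<n. (cyclic_shift ^^ i) ` U) = carrier_vec n"

definition codim_vec :: "nat \<Rightarrow> 'a :: field vec set \<Rightarrow> nat" where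
  "codim_vec n U = n - vectorspace.dim class_ring ((module_vec TYPE('a) n)\<lparr>carrier := U\<rparr>)"

text \<open>The field is passed as a type; the maximum is over a set of naturals bounded by \<open>n\<close>,
  which for \<open>n > 0\<close> contains the codimension of the whole space.\<close>

definition cyclic_cover_codim :: "'a :: {finite, field} itself \<Rightarrow> nat \<Rightarrow> nat" where
  "cyclic_cover_codim _ n = Max {codim_vec n U | U :: 'a vec set. cyclically_covering n U}"

end

theory Submission
  imports Defs
begin

hide_const (open) up_ring.coeff up_ring.monom

text \<open>
  A proper subspace lies in the hyperplane orthogonal to some nonzero \<open>w\<close>, so it suffices to find,
  for every nonzero \<open>f\<close> in \<open>R = F\<^sub>q[x]/(x\<^sup>n - 1)\<close> with \<open>n = l\<^sup>t\<close>, a multiple of \<open>f\<close> without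
  vanishing coefficients. Some power \<open>e\<close> of \<open>f\<close> is a nonzero idempotent, and \<open>e = e\<^sup>q = e(x\<^sup>q)\<close>
  shows that the coefficients of \<open>e\<close> are invariant under multiplication of the index by \<open>q\<close>, hence
  by every integer prime to \<open>l\<close>. Choose \<open>s\<close> minimal such that the coefficients of \<open>e\<close> at all
  multiples of \<open>l\<^sup>s\<close> agree. If \<open>s = 0\<close>, then \<open>e\<close> is constant and the all-ones vector is a multiple.
  Otherwise \<open>e\<close> acts as a nonzero scalar on the \<open>l\<^sup>s\<close>-periodic vectors whose sums over the
  cosets of \<open>l\<^sup>s\<^sup>-\<^sup>1\<int>\<close> vanish; since \<open>q > 2\<close> and \<open>l\<close> is odd, there is such a vector without zero
  entries.
\<close>

text \<open>Polynomials act by convolution on functions on the integers; restricted to \<open>n\<close>-periodic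
  functions this is an action of \<open>F[x]/(x\<^sup>n - 1)\<close>, which avoids working with residue classes.\<close>

definition conv :: "'a::comm_ring_1 poly \<Rightarrow> (int \<Rightarrow> 'a) \<Rightarrow> int \<Rightarrow> 'a" where
  "conv g u i = (\<Sum>j\<le>degree g. coeff g j * u (i - int j))"

lemma conv_0 [simp]: "conv 0 u i = 0"
  by (simp add: conv_def)

lemma conv_pCons [simp]: "conv (pCons a g) u i = a * u i + conv g u (i - 1)"
proof (cases "g = 0")
  case False
  then show ?thesis
    by (simp add: conv_def sum.atMost_Suc_shift algebra_simps del: sum.atMost_Suc)
qed (simp add: conv_def)

lemma conv_translate: "conv g (\<lambda>j. u (j + d)) i = conv g u (i + d)"
  by (simp add: conv_def algebra_simps)

lemma conv_add: "conv (f + g) u i = conv f u i + conv g u i"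
  by (induction f g arbitrary: i rule: poly_induct2) (simp_all add: algebra_simps)

lemma conv_smult: "conv (Polynomial.smult c g) u i = c * conv g u i"
  by (induction g arbitrary: i) (simp_all add: algebra_simps)

lemma conv_mult: "conv (f * g) u i = conv f (conv g u) i"
  by (induction f arbitrary: i) (simp_all add: mult_pCons_left conv_add conv_smult)

lemma conv_monom: "conv (monom c k) u i = c * u (i - int k)"
  by (induction k arbitrary: i) (simp_all add: monom_0 monom_Suc algebra_simps)

lemma conv_sum: "conv (sum f A) u i = (\<Sum>x\<in>A. conv (f x) u i)"
  by (induction A rule: infinite_finite_induct) (simp_all add: conv_add)

text \<open>Since \<open>x^k\<close> acts as the shift by \<open>k\<close>, the substituted
  polynomial samples \<open>u\<close> along the arithmetic progression of difference
  \<open>k\<close> through \<open>i\<close>.\<close>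

lemma conv_pcompose_monom:
  "conv (pcompose g (monom 1 k)) u i = conv g (\<lambda>j. u (i + int k * j)) 0"
proof (induction g arbitrary: i)
  case (pCons a g)
  have "conv g (\<lambda>j. u (i - int k + int k * j)) 0 = conv g (\<lambda>j. u (i + int k * j)) (-1)"
    using conv_translate[of g "\<lambda>j. u (i + int k * j)" "-1" 0] by (simp add: algebra_simps)
  with pCons show ?case
    by (simp add: pcompose_pCons conv_add conv_mult conv_monom)
qed simp

section \<open>Periodic functions and coefficients modulo \<open>x^n - 1\<close>\<close>

definition periodic :: "int \<Rightarrow> (int \<Rightarrow> 'a) \<Rightarrow> bool" where
  "periodic n u \<longleftrightarrow> (\<forall>a b. [a = b] (mod n) \<longrightarrow> u a = u b)"

lemma periodicD: "periodic n u \<Longrightarrow> [a = b] (mod n) \<Longrightarrow> u a = u b"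
  by (auto simp: periodic_def)

lemma periodic_conv:
  assumes "periodic n u"
  shows "periodic n (conv g u)"
proof -
  have "u (a - k) = u (b - k)" if "[a = b] (mod n)" for a b k
    using that by (intro periodicD[OF assms]) (rule cong_diff, simp_all)
  then show ?thesis
    unfolding periodic_def conv_def by (intro allI impI sum.cong refl) simp
qed

lemma sum_periodic_shift:
  fixes n :: int and g :: "int \<Rightarrow> 'a::comm_ring_1"
  assumes "n > 0" "periodic n g"
  shows "(\<Sum>r\<in>{0..<n}. g (r + c)) = (\<Sum>r\<in>{0..<n}. g r)"
  by (rule sum.reindex_bij_witness[of _ "\<lambda>r. (r - c) mod n" "\<lambda>r. (r + c) mod n"])
     (use assms in \<open>auto simp: mod_simps intro!: periodicD[OF assms(2)] simp: cong_def\<close>)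

text \<open>This is the class of 1 in \<open>F[x]/(x^n - 1)\<close>, written as a periodic function;
  hence \<open>conv g (delta n) r\<close> is the coefficient of \<open>x^r\<close> in the class of
  \<open>g\<close>.\<close>

definition delta :: "int \<Rightarrow> int \<Rightarrow> 'a::comm_ring_1" where
  "delta n i = of_bool (n dvd i)"

lemma periodic_delta: "periodic n (delta n)"
  by (auto simp: periodic_def delta_def cong_dvd_iff cong_def dvd_eq_mod_eq_0)

lemma sum_delta_shift:
  assumes "n > 0" "periodic n u"
  shows "(\<Sum>r\<in>{0..<n}. delta n (r - j) * u (i - r)) = u (i - j)"
proof -
  have "(\<Sum>r\<in>{0..<n}. delta n (r - j) * u (i - r)) =
      (\<Sum>r\<in>{0..<n}. if r = j mod n then u (i - r) else 0)"
    using assms(1) by (intro sum.cong) (auto simp: delta_def mod_eq_dvd_iff[symmetric])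
  also have "\<dots> = u (i - j mod n)"
    using assms(1) by simp
  also have "\<dots> = u (i - j)"
    by (rule periodicD[OF assms(2)]) (simp add: cong_def mod_simps)
  finally show ?thesis .
qed

text \<open>On periodic functions only the class of \<open>g\<close> modulo \<open>x^n - 1\<close>
  matters, so its coefficients, read off from \<open>delta n\<close>, can replace those of
  \<open>g\<close>.\<close>

lemma conv_eq_sum_delta:
  assumes "n > 0" "periodic n u"
  shows "conv g u i = (\<Sum>r\<in>{0..<n}. conv g (delta n) r * u (i - r))"
proof -
  have "(\<Sum>r\<in>{0..<n}. conv g (delta n) r * u (i - r)) =
      (\<Sum>j\<le>degree g. coeff g j * (\<Sum>r\<in>{0..<n}. delta n (r - int j) * u (i - r)))"
    unfolding conv_def sum_distrib_left sum_distrib_right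
    by (subst sum.swap) (simp add: mult.assoc)
  then show ?thesis
    using assms by (simp add: sum_delta_shift conv_def)
qed

section \<open>Frobenius powers over a finite field\<close>

lemma power_CARD_eq_same:
  fixes x :: "'a::{finite,field}"
  shows "x ^ CARD('a) = x"
proof (cases "x = 0")
  case False
  \<comment> \<open>Multiplication by \<open>x\<close> permutes the nonzero elements, so their
    product does not change.\<close>
  have "(\<Prod>y\<in>UNIV-{0}. x * y) = (\<Prod>y\<in>UNIV-{0::'a}. y)"
    by (rule prod.reindex_bij_witness[of _ "\<lambda>y. y / x" "\<lambda>y. x * y"]) (use False in auto)
  then have "x ^ (CARD('a) - 1) = 1"
    by (simp add: prod.distrib card_Diff_singleton)
  then show ?thesis
    by (metis One_nat_def Suc_pred finite power_Suc mult_1_right zero_less_card_finite)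
qed auto

lemma power_CARD_power_eq_same:
  fixes x :: "'a::{finite,field}"
  shows "x ^ (CARD('a) ^ m) = x"
  by (induction m) (simp_all add: power_mult power_CARD_eq_same)

lemma CHAR_eqI_CARD:
  assumes "prime p" "CARD('a::{finite,field}) = p ^ k"
  shows "CHAR('a) = p"
proof -
  have "prime CHAR('a)"
    using finite_imp_CHAR_pos[where ?'a = 'a] prime_CHAR_semidom[where ?'a = 'a] by simp
  moreover have "CHAR('a) dvd p ^ k"
    using CHAR_dvd_CARD[where ?'a = 'a] assms by simp
  ultimately show ?thesis
    using assms(1) prime_dvd_power primes_dvd_imp_eq by blast
qed

text \<open>Raising to this power is additive in characteristic \<open>p\<close> and fixes all
  constants, so only the variable is affected.\<close>

lemma power_CARD_power_poly:
  fixes g :: "'a::{finite,field} poly"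
  assumes "prime p" "CARD('a) = p ^ k"
  shows "g ^ (CARD('a) ^ m) = pcompose g (monom 1 (CARD('a) ^ m))"
proof (induction g)
  case 0
  then show ?case by (simp add: power_0_left)
next
  case (pCons a g)
  let ?Q = "CARD('a) ^ m"
  have char: "CHAR('a poly) = p"
    using CHAR_eqI_CARD[OF assms] by simp
  have "pCons a g = [:a:] + monom 1 1 * g"
    by (simp add: monom_altdef)
  then have "pCons a g ^ ?Q = ([:a:] + monom 1 1 * g) ^ ?Q"
    by simp
  also have "\<dots> = [:a:] ^ ?Q + (monom 1 1 * g) ^ ?Q"
    using assms char by (intro freshmans_dream'[of _ "k * m"]) (simp_all add: power_mult)
  also have "\<dots> = [:a:] + monom 1 ?Q * g ^ ?Q"
    by (simp add: power_mult_distrib monom_power poly_const_pow power_CARD_power_eq_same)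
  finally show ?case
    by (simp add: pCons pcompose_pCons)
qed

section \<open>Nowhere vanishing periodic functions\<close>

lemma exists_nonzero_sum_zero:
  assumes "CARD('a::{finite,field}) > 2"
  shows "\<exists>b :: nat \<Rightarrow> 'a. (\<forall>j. b j \<noteq> 0) \<and> (\<Sum>j<2 * m + 3. b j) = 0"
proof (induction m)
  case 0
  \<comment> \<open>A third field element \<open>x\<close>, different from 0 and -1, makes
    \<open>x\<close>, \<open>-1 - x\<close> and 1 nonzero summands of sum 0.\<close>
  have "card {0, -1 :: 'a} \<le> 2"
    by (simp add: card_insert_if)
  then have "{0, -1 :: 'a} \<noteq> UNIV"
    using assms by (metis leD)
  then obtain x :: 'a where x: "x \<noteq> 0" "x \<noteq> -1"
    by auto
  define b where "b j = (if j = 0 then x else if j = 1 then - 1 - x else 1)" for j :: nat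
  have "b j \<noteq> 0" for j
    using x by (auto simp: b_def)
  moreover have "(\<Sum>j<2 * 0 + 3. b j) = 0"
    by (simp add: b_def eval_nat_numeral)
  ultimately show ?case
    by blast
next
  case (Suc m)
  then obtain b :: "nat \<Rightarrow> 'a" where b: "\<And>j. b j \<noteq> 0" "(\<Sum>j<2 * m + 3. b j) = 0"
    by blast
  \<comment> \<open>Appending 1 and -1 lengthens the sum by two, so every odd length from 3 on is
    reached.\<close>
  define c where "c = b(2 * m + 3 := 1, 2 * m + 4 := -1)"
  have "(\<Sum>j<2 * m + 3. c j) = (\<Sum>j<2 * m + 3. b j)"
    by (intro sum.cong) (auto simp: c_def)
  then have "(\<Sum>j<2 * Suc m + 3. c j) = 0"
    using b(2) by (simp add: c_def eval_nat_numeral)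
  moreover have "c j \<noteq> 0" for j
    using b(1) by (simp add: c_def)
  ultimately show ?case
    by blast
qed

text \<open>Let \<open>u\<close> be constant on blocks of length \<open>d\<close>, with
  \<open>l\<close> nonzero block values of sum 0 repeated cyclically. A step by \<open>d\<close>
  leads to the next block, so each sum runs once through all block values.\<close>

lemma exists_periodic_nonzero_sum_zero:
  assumes "CARD('a::{finite,field}) > 2" "odd l" "l > 1" "d > 0"
  shows "\<exists>u :: int \<Rightarrow> 'a. periodic (d * int l) u \<and> (\<forall>i. u i \<noteq> 0) \<and>
    (\<forall>i. (\<Sum>j\<in>{0..<int l}. u (i + d * j)) = 0)"
proof -
  have "l = 2 * ((l - 3) div 2) + 3"
    using assms(2,3) by presburger
  then obtain b :: "nat \<Rightarrow> 'a" where b: "\<And>j. b j \<noteq> 0" "(\<Sum>j<l. b j) = 0"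
    using exists_nonzero_sum_zero[OF assms(1), of "(l - 3) div 2"] by auto
  define v where "v i = b (nat (i mod int l))" for i
  have v: "periodic (int l) v"
    by (simp add: periodic_def v_def cong_def)
  define u where "u i = v (i div d)" for i
  have "periodic (d * int l) u"
    unfolding periodic_def
  proof (intro allI impI)
    fix a b assume "[a = b] (mod d * int l)"
    then obtain k where "b = a + d * int l * k"
      by (auto simp: cong_iff_lin)
    then have "b div d = a div d + int l * k"
      using assms(4) by (simp add: mult.assoc)
    then show "u a = u b"
      unfolding u_def by (intro periodicD[OF v]) (simp add: cong_def)
  qed
  moreover have "u i \<noteq> 0" for i
    by (simp add: u_def v_def b)
  moreover have "(\<Sum>j\<in>{0..<int l}. u (i + d * j)) = 0" for i
  proof -
    have "(\<Sum>j\<in>{0..<int l}. u (i + d * j)) = (\<Sum>j\<in>{0..<int l}. v (j + i div d))"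
      using assms(4) by (simp add: u_def add.commute)
    also have "\<dots> = (\<Sum>j\<in>{0..<int l}. v j)"
      using assms(3) v by (intro sum_periodic_shift) auto
    also have "\<dots> = (\<Sum>j<l. b j)"
      by (rule sum.reindex_bij_witness[of _ int nat]) (auto simp: v_def)
    finally show ?thesis
      using b by simp
  qed
  ultimately show ?thesis
    by blast
qed

text \<open>For \<open>s > 0\<close> and \<open>d = l^(s-1)\<close>, \<open>e\<close> is a nonzero
  scalar times the indicator of the multiples of \<open>l^s\<close>, plus a
  \<open>d\<close>-periodic remainder. For \<open>u\<close> as in the previous lemma the remainder
  contributes nothing, and the indicator multiplies \<open>u\<close> by the power \<open>m\<close>
  of \<open>l\<close>, which is invertible in the field.\<close>

lemma exists_nonzero_conv_of_coprime_invariant: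
  fixes e :: "int \<Rightarrow> 'a::{finite,field}"
  assumes "CARD('a) > 2" "prime l" "odd l" "of_nat l \<noteq> (0::'a)"
    and e: "periodic (int (l ^ t)) e" "\<And>a i. coprime a (int l) \<Longrightarrow> e (a * i) = e i"
    and nz: "e i0 \<noteq> 0"
  shows "\<exists>u. periodic (int (l ^ t)) u \<and> (\<forall>i. (\<Sum>r\<in>{0..<int (l ^ t)}. e r * u (i - r)) \<noteq> 0)"
proof -
  define n where "n = int (l ^ t)"
  have l: "l > 1"
    using assms(2) prime_gt_1_nat by blast
  then have n: "n > 0"
    by (simp add: n_def)
  define P where "P s \<longleftrightarrow> (\<forall>j. int (l ^ s) dvd j \<longrightarrow> e j = e 0)" for s
  have "P t"
    unfolding P_def using e(1) by (auto intro: periodicD simp: cong_0_iff)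
  define s where "s = (LEAST s. P s)"
  have s: "P s" "s \<le> t" "\<And>r. r < s \<Longrightarrow> \<not> P r"
    using \<open>P t\<close> by (auto simp: s_def intro: LeastI Least_le dest: not_less_Least)
  show ?thesis
  proof (cases s)
    case 0
    then have e0: "e j = e 0" for j
      using s(1) by (simp add: P_def)
    have eq: "e j = e i0" for j
      using e0[of j] e0[of i0] by simp
    have "(\<Sum>r\<in>{0..<n}. e r * 1) = (\<Sum>r\<in>{0..<n}. e i0)"
      by (intro sum.cong refl) (simp only: mult_1_right, rule eq)
    also have "\<dots> = of_nat l ^ t * e i0"
      by (simp add: n_def)
    finally have "(\<Sum>r\<in>{0..<n}. e r * 1) = of_nat l ^ t * e i0" .
    then have "(\<Sum>r\<in>{0..<n}. e r * 1) \<noteq> 0"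
      using assms(4) nz by simp
    then show ?thesis
      by (intro exI[of _ "\<lambda>_. 1"]) (simp add: periodic_def n_def)
  next
    case (Suc s')
    define d where "d = int (l ^ s')"
    define m where "m = l ^ (t - s)"
    have d: "d > 0"
      using l by (simp add: d_def)
    have ds: "int (l ^ s) = d * int l"
      by (simp add: Suc d_def)
    have "l ^ t = l ^ s * m"
      using s(2) by (simp add: m_def flip: power_add)
    then have nd: "n = d * int l * int m"
      unfolding ds[symmetric] n_def by (simp only: of_nat_mult)
    obtain u :: "int \<Rightarrow> 'a" where u: "periodic (d * int l) u" "\<And>i. u i \<noteq> 0"
      "\<And>i. (\<Sum>j\<in>{0..<int l}. u (i + d * j)) = 0"
      using exists_periodic_nonzero_sum_zero[OF assms(1,3) l d] by metis
    have un: "periodic n u"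
      unfolding periodic_def nd
    proof (intro allI impI)
      fix a b assume "[a = b] (mod d * int l * int m)"
      then show "u a = u b"
        by (intro periodicD[OF u(1)]) (rule cong_modulus_mult)
    qed
    have cop: "coprime a (int l)" if "\<not> int l dvd a" for a
    proof -
      have "prime (int l)"
        using assms(2) by simp
      then show ?thesis
        using that by (rule coprime_commute[THEN iffD1, OF prime_imp_coprime])
    qed
    \<comment> \<open>Such a \<open>j\<close> is \<open>d\<close> times an integer prime to
      \<open>l\<close>.\<close>
    have multiple: "e j = e d" if "d dvd j" "\<not> d * int l dvd j" for j
    proof -
      from that obtain a where a: "j = d * a"
        by auto
      with that d have "\<not> int l dvd a"
        by simp
      then have "coprime a (int l)"
        by (rule cop)
      then show ?thesis
        using e(2)[of a d] by (simp add: a mult.commute)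
    qed
    have e0: "e j = e 0" if "d * int l dvd j" for j
      using that s(1) unfolding P_def ds by blast
    \<comment> \<open>Equality would make \<open>e\<close> constant on the multiples of
      \<open>d\<close>, against the minimality of \<open>s\<close>.\<close>
    have ed: "e d \<noteq> e 0"
    proof
      assume "e d = e 0"
      then have "e j = e 0" if "d dvd j" for j
        using multiple[OF that] e0[of j] by (cases "d * int l dvd j") simp_all
      then have "P s'"
        unfolding P_def d_def by blast
      then show False
        using s(3)[of s'] Suc by simp
    qed
    \<comment> \<open>the remainder \<open>e'\<close> is \<open>d\<close>-periodic, so its convolution with \<open>u\<close> vanishes\<close>
    define e' where "e' r = e r - (if d * int l dvd r then e 0 - e d else 0)" for r
    have e': "e' (r + d * j) = e' r" for r j
    proof (cases "d dvd r")
      case True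
      \<comment> \<open>The subtracted term levels \<open>e\<close> on all multiples of
        \<open>d\<close>, and \<open>r + d * j\<close> is one together with
        \<open>r\<close>.\<close>
      have "e' r = e d" if "d dvd r" for r
        using multiple[OF that] e0[of r] by (cases "d * int l dvd r") (simp_all add: e'_def)
      with True show ?thesis
        by simp
    next
      case False
      then have r: "r \<noteq> 0"
        by auto
      \<comment> \<open>Outside the multiples of \<open>d\<close> the exponent of \<open>l\<close>
        in \<open>r\<close> is below \<open>s'\<close>. Adding \<open>d * j\<close> preserves it,
        and \<open>e\<close> depends only on this exponent.\<close>
      define k where "k = multiplicity (int l) r"
      obtain a where a: "r = int l ^ k * a" "\<not> int l dvd a"
        using r l multiplicity_decompose'[of r "int l"] unfolding k_def by (auto)
      have "k < s'"
      proof (rule ccontr)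
        assume "\<not> k < s'"
        then have "int l ^ s' dvd int l ^ k"
          by (intro le_imp_power_dvd) simp
        then show False
          using False by (simp add: a(1) d_def)
      qed
      define b where "b = a + int l ^ (s' - k) * j"
      have b: "r + d * j = int l ^ k * b"
        using \<open>k < s'\<close> by (simp add: a(1) b_def d_def algebra_simps flip: power_add)
      have "int l dvd int l ^ (s' - k) * j"
        using \<open>k < s'\<close> by simp
      then have "\<not> int l dvd b"
        using a(2) by (simp add: b_def dvd_add_left_iff)
      have "coprime a (int l)" "coprime b (int l)"
        using a(2) \<open>\<not> int l dvd b\<close> by (simp_all add: cop)
      then have "e (r + d * j) = e r"
        using e(2)[of a "int l ^ k"] e(2)[of b "int l ^ k"] by (simp add: b) (simp add: a(1) mult.commute)
      moreover have "\<not> d dvd r + d * j"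
        using False by (simp add: dvd_add_left_iff)
      then have "\<not> d * int l dvd r" "\<not> d * int l dvd r + d * j"
        using False dvd_mult_left by blast+
      ultimately show ?thesis
        by (simp add: e'_def)
    qed
    have e'n: "periodic n e'"
      unfolding periodic_def
    proof (intro allI impI)
      fix a b assume "[a = b] (mod n)"
      then obtain k where "b = a + d * (int l * int m * k)"
        by (auto simp: cong_iff_lin nd mult.assoc)
      then show "e' a = e' b"
        by (simp only: e')
    qed
    have "(\<Sum>r\<in>{0..<n}. e r * u (i - r)) = of_nat m * (e 0 - e d) * u i" for i
    proof -
      \<comment> \<open>Translating \<open>r\<close> by a multiple of \<open>d\<close> changes only
        the argument of \<open>u\<close>.\<close>
      have shift: "(\<Sum>r\<in>{0..<n}. e' r * u (i - r)) = (\<Sum>r\<in>{0..<n}. e' r * u (i - r + d * j))" for j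
      proof -
        have "periodic n (\<lambda>r. e' r * u (i - r))"
          unfolding periodic_def
        proof (intro allI impI)
          fix a b assume ab: "[a = b] (mod n)"
          then have "[i - a = i - b] (mod n)"
            by (intro cong_diff) simp_all
          with ab show "e' a * u (i - a) = e' b * u (i - b)"
            using periodicD[OF e'n] periodicD[OF un] by simp
        qed
        from sum_periodic_shift[OF n this, of "- (d * j)"] show ?thesis
          using e'[of _ "- j"] by (simp add: algebra_simps)
      qed
      \<comment> \<open>Adding up the \<open>l\<close> translates produces the vanishing sums of
        \<open>u\<close>; then \<open>l\<close> is cancelled.\<close>
      have "of_nat l * (\<Sum>r\<in>{0..<n}. e' r * u (i - r)) =
          (\<Sum>j\<in>{0..<int l}. \<Sum>r\<in>{0..<n}. e' r * u (i - r + d * j))"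
        by (simp flip: shift)
      also have "\<dots> = (\<Sum>r\<in>{0..<n}. e' r * (\<Sum>j\<in>{0..<int l}. u (i - r + d * j)))"
        by (subst sum.swap) (simp add: sum_distrib_left)
      also have "\<dots> = 0"
        by (simp add: u)
      finally have "(\<Sum>r\<in>{0..<n}. e' r * u (i - r)) = 0"
        using assms(4) by simp
      moreover have "(\<Sum>r\<in>{0..<n}. e r * u (i - r)) = (\<Sum>r\<in>{0..<n}. e' r * u (i - r)) +
         (\<Sum>r\<in>{0..<n}. if d * int l dvd r then (e 0 - e d) * u (i - r) else 0)"
        by (simp add: e'_def algebra_simps flip: sum.distrib) (intro sum.cong, auto simp: algebra_simps)
      moreover have "(\<Sum>r\<in>{0..<n}. if d * int l dvd r then (e 0 - e d) * u (i - r) else 0) =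
          (\<Sum>k\<in>{0..<int m}. (e 0 - e d) * u (i - d * int l * k))"
      proof -
        have "(\<Sum>r\<in>{0..<n}. if d * int l dvd r then (e 0 - e d) * u (i - r) else 0) =
            (\<Sum>r\<in>{r\<in>{0..<n}. d * int l dvd r}. (e 0 - e d) * u (i - r))"
          by (intro sum.inter_filter[symmetric]) simp
        also have "\<dots> = (\<Sum>k\<in>{0..<int m}. (e 0 - e d) * u (i - d * int l * k))"
          by (rule sum.reindex_bij_witness[of _ "\<lambda>k. d * int l * k" "\<lambda>r. r div (d * int l)"])
             (use d l in \<open>auto simp: nd div_less_iff_less_mult pos_imp_zdiv_nonneg_iff elim!: dvdE\<close>)
        finally show ?thesis .
      qed
      moreover have "u (i - d * int l * k) = u i" for k
        by (rule periodicD[OF u(1)]) (simp add: cong_iff_lin, algebra)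
      ultimately show ?thesis
        by simp
    qed
    moreover have "of_nat m * (e 0 - e d) * u i \<noteq> 0" for i
      using assms(4) ed u(2) by (simp add: m_def)
    ultimately show ?thesis
      using un unfolding n_def by (intro exI[of _ u]) simp
  qed
qed

section \<open>Idempotents and the primitive root condition\<close>

lemma residue_primroot_cong_power:
  assumes "n > 1" "residue_primroot n q" "coprime a (int n)"
  shows "\<exists>k. [a = int q ^ k] (mod int n)"
proof -
  define b where "b = nat (a mod int n)"
  have b: "int b = a mod int n"
    using assms(1) by (simp add: b_def)
  have "coprime (int b) (int n)"
    using assms(1,3) by (simp add: b)
  then have "coprime b n"
    by simp
  moreover have "b < n"
    using assms(1) by (simp add: b_def nat_less_iff)
  moreover have "b \<noteq> 0"
    using \<open>coprime b n\<close> assms(1) by (auto intro!: Nat.gr0I)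
  ultimately have "b \<in> totatives n"
    by (simp add: totatives_def)
  then obtain k where "b = q ^ k mod n"
    using residue_primroot_is_generator[OF assms(1,2)] by (auto simp: bij_betw_def)
  then have "a mod int n = int q ^ k mod int n"
    using b by (simp add: zmod_int)
  then show ?thesis
    by (auto simp: cong_def)
qed

text \<open>The function \<open>v\<close> witnesses that \<open>f\<close> is nonzero modulo
  \<open>x^n - 1\<close>. As \<open>Q\<close> is 1 modulo \<open>n\<close>,
  \<open>f^Q = f(x^Q)\<close> acts as \<open>f\<close> on periodic functions. Hence
  \<open>E = f^(Q-1)\<close> acts as an idempotent, and \<open>E = f * g\<close> turns a
  \<open>u\<close> suitable for \<open>E\<close> into \<open>conv g u\<close>, suitable for
  \<open>f\<close>.\<close>

lemma exists_periodic_conv_nonzero: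
  fixes f :: "'a::{finite,field} poly"
  assumes p: "prime p" "CARD('a) = p ^ k" and "CARD('a) > 2" and l: "prime l" "odd l"
    and t: "t \<ge> 1" and root: "residue_primroot (l ^ t) (CARD('a))"
    and f: "conv f v i0 \<noteq> 0" "periodic (int (l ^ t)) v"
  shows "\<exists>u. periodic (int (l ^ t)) u \<and> (\<forall>i. conv f u i \<noteq> 0)"
proof -
  define n where "n = int (l ^ t)"
  define q where "q = CARD('a)"
  \<comment> \<open>Euler's theorem makes this power of \<open>q\<close> congruent to 1 modulo
    \<open>n\<close>.\<close>
  define Q where "Q = q ^ totient (l ^ t)"
  have n1: "l ^ t > 1"
    using prime_gt_1_nat[OF l(1)] t by (intro one_less_power) auto
  then have lt0: "l ^ t > 0"
    by linarith
  then have n: "n > 0"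
    unfolding n_def by (simp only: of_nat_0_less_iff)
  have cop: "coprime (l ^ t) q"
    using root by (simp add: residue_primroot_def q_def)
  have "totient (l ^ t) \<ge> 1"
    using lt0 by (simp only: Suc_le_eq One_nat_def totient_gt_0_iff)
  then have "q ^ 1 \<le> Q"
    unfolding Q_def using assms(3) by (intro power_increasing) (auto simp: q_def)
  then have Q2: "Q > 2"
    using assms(3) by (simp add: q_def)
  have Q1: "[int Q = 1] (mod n)"
  proof -
    have "[Q = 1] (mod l ^ t)"
      unfolding Q_def using cop by (intro euler_theorem) (simp add: coprime_commute)
    then have "[int Q = int 1] (mod n)"
      unfolding n_def by (simp only: cong_int_iff)
    then show ?thesis
      by simp
  qed
  have fQ: "conv (f ^ Q) u i = conv f u i" if u: "periodic n u" for u i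
  proof -
    have "conv (f ^ Q) u i = conv f (\<lambda>j. u (i + int Q * j)) 0"
      unfolding Q_def q_def power_CARD_power_poly[OF p] conv_pcompose_monom ..
    also have "(\<lambda>j. u (i + int Q * j)) = (\<lambda>j. u (j + i))"
    proof
      fix j
      have "[i + int Q * j = i + 1 * j] (mod n)"
        using Q1 by (intro cong_add cong_mult) simp_all
      then show "u (i + int Q * j) = u (j + i)"
        using periodicD[OF u] by (simp add: add.commute)
    qed
    finally show ?thesis
      by (simp add: conv_translate)
  qed
  define g where "g = f ^ (Q - 2)"
  define E where "E = f ^ (Q - 1)"
  have E: "E = f * g"
    unfolding E_def g_def using Q2 by (simp flip: power_Suc add: Suc_diff_Suc numeral_2_eq_2)
  have EE: "conv (E * E) u i = conv E u i" if u: "periodic n u" for u i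
  proof -
    have "(Q - 1) + (Q - 1) = Q + (Q - 2)"
      using Q2 by simp
    then have "E * E = f ^ Q * g"
      unfolding E_def g_def by (simp only: flip: power_add)
    then have "conv (E * E) u i = conv (f ^ Q) (conv g u) i"
      by (simp only: conv_mult)
    also have "\<dots> = conv f (conv g u) i"
      by (rule fQ[OF periodic_conv[OF u]])
    finally show ?thesis
      by (simp only: E conv_mult)
  qed
  have Epow: "conv (E ^ Suc m) u i = conv E u i" if u: "periodic n u" for m u i
  proof (induction m arbitrary: i)
    case (Suc m)
    have "conv (E ^ Suc (Suc m)) u i = conv E (conv (E ^ Suc m) u) i"
      by (metis conv_mult power_Suc)
    also have "conv (E ^ Suc m) u = conv E u"
      using Suc by blast
    finally show ?case
      using EE[OF u] by (simp add: conv_mult)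
  qed simp
  define e where "e = conv E (delta n)"
  have en: "periodic n e"
    unfolding e_def by (intro periodic_conv periodic_delta)
  \<comment> \<open>Idempotence gives \<open>E^q = E\<close> and Frobenius gives
    \<open>E^q = E(x^q)\<close>; the coefficients at \<open>q * i\<close> are compared.\<close>
  have eq: "e (int q * i) = e i" for i
  proof -
    have "e (int q * i) = conv (E ^ q) (delta n) (int q * i)"
      unfolding e_def using Epow[OF periodic_delta, of "q - 1"] assms(3) by (simp add: q_def)
    also have "\<dots> = conv E (\<lambda>j. delta n (int q * i + int q * j)) 0"
      using power_CARD_power_poly[OF p, of E 1] by (simp add: q_def conv_pcompose_monom)
    also have "(\<lambda>j. delta n (int q * i + int q * j)) = (\<lambda>j. delta n (j + i) :: 'a)"
    proof
      fix j
      have "coprime n (int q)"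
        unfolding n_def using cop by (simp only: coprime_int_iff)
      then have "n dvd int q * (j + i) \<longleftrightarrow> n dvd j + i"
        by (rule coprime_dvd_mult_right_iff)
      then show "delta n (int q * i + int q * j) = (delta n (j + i) :: 'a)"
        by (simp add: delta_def algebra_simps)
    qed
    finally show ?thesis
      by (simp add: conv_translate e_def)
  qed
  have eqk: "e (int q ^ k * i) = e i" for k i
    by (induction k arbitrary: i) (simp_all add: eq mult.assoc)
  have ecop: "e (a * i) = e i" if "coprime a (int l)" for a i
  proof -
    have "coprime a (int (l ^ t))"
      using that by simp
    then obtain k where "[a = int q ^ k] (mod n)"
      using residue_primroot_cong_power[OF n1 root] unfolding n_def q_def by blast
    then have "[a * i = int q ^ k * i] (mod n)"
      by (intro cong_mult) simp_all
    then show ?thesis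
      using periodicD[OF en] eqk by simp
  qed
  \<comment> \<open>If all coefficients of \<open>E\<close> vanished, then so would
    \<open>f * E = f^Q\<close>, which acts as \<open>f\<close>, contradicting the choice of
    \<open>v\<close>.\<close>
  have "\<exists>j. e j \<noteq> 0"
  proof (rule ccontr)
    assume "\<not> ?thesis"
    then have "conv E v i = 0" for i
      using conv_eq_sum_delta[OF n, of v E i] f(2) by (simp add: n_def e_def)
    then have "conv f (conv E v) i0 = 0"
      by (simp add: conv_def)
    moreover have "f * E = f ^ Q"
      unfolding E_def using Q2 by (simp flip: power_Suc)
    ultimately have "conv (f ^ Q) v i0 = 0"
      by (metis conv_mult)
    with f fQ show False
      by (simp add: n_def)
  qed
  then obtain j where j: "e j \<noteq> 0" ..
  \<comment> \<open>Otherwise \<open>l = p\<close>, and \<open>q\<close> would not be prime to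
    \<open>l^t\<close>.\<close>
  have "of_nat l \<noteq> (0 :: 'a)"
  proof
    assume "of_nat l = (0 :: 'a)"
    then have "p dvd l"
      using CHAR_eqI_CARD[OF p] of_nat_eq_0_iff_char_dvd[where ?'a = 'a] by simp
    then have "p = l"
      using p l primes_dvd_imp_eq by blast
    moreover have "k \<noteq> 0"
      using p assms(3) by (auto intro!: Nat.gr0I)
    ultimately show False
      using cop p t l by (simp add: q_def)
  qed
  then obtain u where u: "periodic n u" "\<And>i. (\<Sum>r\<in>{0..<n}. e r * u (i - r)) \<noteq> 0"
    using exists_nonzero_conv_of_coprime_invariant[OF assms(3) l(1,2) _ _ ecop j] en unfolding n_def by blast
  have "conv f (conv g u) i \<noteq> 0" for i
    using u(2)[of i] conv_eq_sum_delta[OF n u(1), of E i] by (simp add: e_def E conv_mult)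
  then show ?thesis
    using periodic_conv[OF u(1)] unfolding n_def by blast
qed

section \<open>Hyperplanes and cyclically covering subspaces\<close>

lemma funpow_cyclic_shift:
  assumes "z \<in> carrier_vec n" "j < n"
  shows "(cyclic_shift ^^ i) z \<in> carrier_vec n" "(cyclic_shift ^^ i) z $ ((j + i) mod n) = z $ j"
proof (induction i)
  case (Suc i)
  {
    case 1
    then show ?case
      using Suc(1) by (simp add: cyclic_shift_def)
  next
    case 2
    have "((j + Suc i) mod n + n - 1) mod n = (j + i) mod n"
      using assms(2) by (auto simp: mod_Suc)
    then show ?case
      using Suc assms(2) by (simp add: cyclic_shift_def)
  }
qed (use assms in simp_all)

text \<open>Fewer than \<open>n\<close> homogeneous linear equations in \<open>n\<close> unknowns
  have a nonzero solution. The vectors become rows of a square matrix padded with zero rows, whose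
  determinant is 0.\<close>

lemma exists_orthogonal_vec:
  fixes B :: "'a::field vec set"
  assumes "finite B" "B \<subseteq> carrier_vec n" "card B < n"
  shows "\<exists>w \<in> carrier_vec n. w \<noteq> 0\<^sub>v n \<and> (\<forall>b\<in>B. w \<bullet> b = 0)"
proof -
  obtain bs where bs: "set bs = B" "length bs = card B"
    using assms(1) by (metis finite_distinct_list distinct_card)
  define c where "c i = (if i < length bs then bs ! i else 0\<^sub>v n)" for i
  have c: "c i \<in> carrier_vec n" for i
    using assms(2) bs by (auto simp: c_def)
  \<comment> \<open>The last row lies beyond the list \<open>bs\<close>; writing its zero out
    explicitly lets \<open>det_row_0\<close> apply.\<close>
  define A where "A = mat\<^sub>r n n (\<lambda>i. if i = n - 1 then 0\<^sub>v n else c i)"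
  have A: "A \<in> carrier_mat n n"
    by (simp add: A_def)
  have "det A = 0"
    unfolding A_def using assms(3) c by (intro det_row_0) auto
  then obtain w where w: "w \<in> carrier_vec n" "w \<noteq> 0\<^sub>v n" "A *\<^sub>v w = 0\<^sub>v n"
    using det_0_iff_vec_prod_zero_field[OF A] by blast
  have "w \<bullet> b = 0" if "b \<in> B" for b
  proof -
    have "b \<in> set bs"
      using that bs(1) by simp
    then obtain i where i: "i < length bs" "b = bs ! i"
      by (auto simp: in_set_conv_nth)
    then have "(A *\<^sub>v w) $ i = row A i \<bullet> w"
      using assms(3) bs A by simp
    moreover have "row A i = b"
    proof (cases "i = n - 1")
      case False
      then show ?thesis
        using i assms(3) bs c[of i] by (simp add: A_def c_def)
    qed (use i assms(3) bs in simp)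
    ultimately show ?thesis
      using w i assms(3) bs c[of i] comm_scalar_prod[of w n b] by (simp add: c_def)
  qed
  then show ?thesis
    using w by blast
qed

lemma finite_carrier_vec: "finite (carrier_vec n :: 'a::finite vec set)"
proof (rule finite_subset)
  show "carrier_vec n \<subseteq> vec_of_list ` {xs :: 'a list. set xs \<subseteq> UNIV \<and> length xs = n}"
  proof
    fix v :: "'a vec" assume "v \<in> carrier_vec n"
    then show "v \<in> vec_of_list ` {xs. set xs \<subseteq> UNIV \<and> length xs = n}"
      by (intro image_eqI[of _ _ "list_of_vec v"]) (simp_all add: vec_list)
  qed
  show "finite (vec_of_list ` {xs :: 'a list. set xs \<subseteq> UNIV \<and> length xs = n})"
    by (intro finite_imageI finite_lists_length_eq) simp
qed

text \<open>A basis of \<open>U\<close> has fewer than \<open>n\<close> elements, and a vector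
  orthogonal to the basis is orthogonal to its span.\<close>

lemma exists_orthogonal_subspace:
  fixes U :: "'a::{finite,field} vec set"
  assumes "VectorSpace.subspace class_ring U (module_vec TYPE('a) n)" "codim_vec n U > 0"
  shows "\<exists>w \<in> carrier_vec n. w \<noteq> 0\<^sub>v n \<and> (\<forall>b\<in>U. w \<bullet> b = 0)"
proof -
  interpret V: vec_space "TYPE('a)" n .
  interpret W: vectorspace class_ring "V.vs U"
    using V.subspace_is_vs[OF assms(1)] .
  have sub: "submodule class_ring U V.V"
    using assms(1) by (simp add: VectorSpace.subspace_def)
  then have U: "U \<subseteq> carrier_vec n"
    by (auto simp: submodule_def)
  have finU: "finite U"
    using U by (rule finite_subset) (rule finite_carrier_vec)
  \<comment> \<open>Over a finite field \<open>U\<close> is a finite spanning set of itself, hence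
    finite-dimensional.\<close>
  have "W.span U = U"
    using W.in_own_span[of U] W.span_is_subset2[of U] by auto
  then have "W.fin_dim"
    unfolding W.fin_dim_def using finU by (intro exI[of _ U]) simp
  then obtain B where B: "finite B" "W.basis B"
    using W.finite_basis_exists by blast
  then have "W.dim = card B" "B \<subseteq> U" "W.span B = U"
    using W.dim_basis by (auto simp: W.basis_def)
  moreover have "V.span B = W.span B"
    using V.span_li_not_depend(1)[OF \<open>B \<subseteq> U\<close> sub] by simp
  moreover obtain w where w: "w \<in> carrier_vec n" "w \<noteq> 0\<^sub>v n" "\<forall>b\<in>B. w \<bullet> b = 0"
    using exists_orthogonal_vec[OF B(1), of n] \<open>B \<subseteq> U\<close> U \<open>W.dim = card B\<close> assms(2)
    by (auto simp: codim_vec_def)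
  ultimately have "w \<in> V.orthogonal_complement U"
    using V.in_orthogonal_complement_span[of B] U by (simp add: V.orthogonal_complement_def)
  then show ?thesis
    using w by (auto simp: V.orthogonal_complement_def)
qed

text \<open>Positive codimension puts \<open>U\<close> into the hyperplane orthogonal to some
  \<open>w\<close>, whose entries become the coefficients of \<open>f\<close>. Scalar products of
  \<open>w\<close> with the shifts of the constructed vector are values of \<open>conv f u\<close>,
  so no shift of that vector lies in \<open>U\<close>.\<close>

lemma cyclically_covering_codim_eq_0:
  fixes U :: "'a::{finite,field} vec set"
  assumes p: "prime p" "CARD('a) = p ^ k" and "CARD('a) > 2" and l: "prime l" "odd l"
    and t: "t \<ge> 1" and root: "residue_primroot (l ^ t) (CARD('a))"
    and U: "cyclically_covering (l ^ t) U"
  shows "codim_vec (l ^ t) U = 0"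
proof (rule ccontr)
  define n where "n = l ^ t"
  assume "codim_vec (l ^ t) U \<noteq> 0"
  then obtain w where w: "w \<in> carrier_vec n" "w \<noteq> 0\<^sub>v n" "\<And>z. z \<in> U \<Longrightarrow> w \<bullet> z = 0"
    using exists_orthogonal_subspace[of U "l ^ t"] U
    by (auto simp: cyclically_covering_def n_def)
  have n: "n > 0"
    using l by (simp add: n_def prime_gt_0_nat)
  define f where "f = (\<Sum>j<n. monom (w $ j) j)"
  have f: "conv f u i = (\<Sum>j<n. w $ j * u (i - int j))" for u i
    by (simp add: f_def conv_sum conv_monom)
  obtain j0 where j0: "j0 < n" "w $ j0 \<noteq> 0"
    using w by (metis carrier_vecD eq_vecI index_zero_vec)
  \<comment> \<open>Indices below \<open>n\<close> are congruent modulo \<open>n\<close> only if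
    equal, so this value is the nonzero entry \<open>w $ j0\<close>.\<close>
  have "conv f (delta (int n)) (int j0) = (\<Sum>j<n. if j = j0 then w $ j else 0)"
    unfolding f delta_def
  proof (intro sum.cong refl)
    fix j assume "j \<in> {..<n}"
    then have "int n dvd int j0 - int j \<longleftrightarrow> j = j0"
      using j0(1) by (metis mod_eq_dvd_iff zmod_int of_nat_eq_iff mod_less lessThan_iff)
    then show "w $ j * of_bool (int n dvd int j0 - int j) = (if j = j0 then w $ j else 0)"
      by simp
  qed
  then have "conv f (delta (int n)) (int j0) \<noteq> 0"
    using j0 by simp
  then obtain u where u: "periodic (int n) u" "\<And>i. conv f u i \<noteq> 0"
    using exists_periodic_conv_nonzero[OF assms(1-7)] periodic_delta unfolding n_def by blast
  \<comment> \<open>The reflection turns the convolution, whose indices run in opposite directions,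
    into a scalar product.\<close>
  define v where "v = vec n (\<lambda>j. u (- int j))"
  have "v \<in> (\<Union>i<n. (cyclic_shift ^^ i) ` U)"
    using U by (simp add: cyclically_covering_def n_def v_def)
  then obtain i z where z: "i < n" "z \<in> U" "v = (cyclic_shift ^^ i) z"
    by blast
  have "U \<subseteq> carrier (module_vec TYPE('a) n)"
    using U by (simp add: cyclically_covering_def VectorSpace.subspace_def submodule_def n_def)
  then have zc: "z \<in> carrier_vec n"
    using z(2) by (auto simp: module_vec_simps)
  have "z $ j = u (- int i - int j)" if "j < n" for j
  proof -
    have "z $ j = v $ ((j + i) mod n)"
      using funpow_cyclic_shift(2)[OF zc that] z by simp
    also have "\<dots> = u (- int ((j + i) mod n))"
      using n by (simp add: v_def)
    also have "\<dots> = u (- int i - int j)"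
      by (rule periodicD[OF u(1)]) (simp add: cong_def zmod_int mod_simps algebra_simps)
    finally show ?thesis .
  qed
  then have "w \<bullet> z = conv f u (- int i)"
    using zc by (simp add: f scalar_prod_def atLeast0LessThan)
  with u(2) w(3) z(2) show False
    by simp
qed

lemma cyclically_covering_carrier_vec:
  assumes "n > 0"
  shows "cyclically_covering n (carrier_vec n :: 'a::field vec set)"
proof -
  interpret V: vec_space "TYPE('a)" n .
  have "VectorSpace.subspace class_ring (carrier_vec n) V.V"
    unfolding VectorSpace.subspace_def submodule_def
    using V.vectorspace_axioms V.module_axioms by (auto)
  moreover have "(\<Union>i<n. (cyclic_shift ^^ i) ` carrier_vec n) = (carrier_vec n :: 'a vec set)"
  proof
    show "(\<Union>i<n. (cyclic_shift ^^ i) ` carrier_vec n) \<subseteq> (carrier_vec n :: 'a vec set)"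
      using funpow_cyclic_shift(1) assms by blast
    show "(carrier_vec n :: 'a vec set) \<subseteq> (\<Union>i<n. (cyclic_shift ^^ i) ` carrier_vec n)"
      using assms by (intro UN_upper[of 0, THEN subset_trans[rotated]]) auto
  qed
  ultimately show ?thesis
    by (simp add: cyclically_covering_def)
qed

lemma codim_vec_carrier_vec:
  "codim_vec n (carrier_vec n :: 'a::field vec set) = 0"
proof -
  interpret V: vec_space "TYPE('a)" n .
  have "V.V\<lparr>carrier := carrier_vec n\<rparr> = V.V"
    by (simp add: module_vec_def)
  then show ?thesis
    unfolding codim_vec_def by (simp only: V.dim_is_n diff_self_eq_0)
qed

theorem theorem3p3:
  fixes p q l :: nat
  assumes "prime p"
    and "\<exists>k\<ge>1. q = p ^ k"
    and "q \<noteq> 2"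
    and "q \<noteq> p ^ 2"
    and "prime l" and "odd l"
    and "\<forall>t\<ge>1. residue_primroot (l ^ t) q"
    and "CARD('a :: {finite, field}) = q"
  shows "\<forall>t\<ge>1. cyclic_cover_codim TYPE('a) (l ^ t) = 0"
proof (intro allI impI)
  fix t :: nat
  assume t: "t \<ge> 1"
  obtain k where k: "k \<ge> 1" "q = p ^ k"
    using assms(2) by blast
  have "p ^ 1 \<le> p ^ k"
    using k(1) prime_gt_0_nat[OF assms(1)] by (intro power_increasing) auto
  then have card: "CARD('a) = p ^ k" "CARD('a) > 2"
    using assms(1,3,8) k prime_ge_2_nat[of p] by auto
  have root: "residue_primroot (l ^ t) (CARD('a))"
    using assms(7,8) t by simp
  have eq_0: "codim_vec (l ^ t) U = 0" if "cyclically_covering (l ^ t) U" for U :: "'a vec set"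
    by (rule cyclically_covering_codim_eq_0[OF assms(1) card assms(5,6) t root that])
  have "cyclically_covering (l ^ t) (carrier_vec (l ^ t) :: 'a vec set)"
    using assms(5) by (intro cyclically_covering_carrier_vec) (simp add: prime_gt_0_nat)
  \<comment> \<open>The whole space shows that the set is nonempty, so \<open>Max\<close> is taken
    over exactly the value 0.\<close>
  then have "{codim_vec (l ^ t) U | U :: 'a vec set. cyclically_covering (l ^ t) U} = {0}"
    using eq_0 by force
  then show "cyclic_cover_codim TYPE('a) (l ^ t) = 0"
    by (simp add: cyclic_cover_codim_def)
qed

end
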